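(* Suppose that $0 \to X \to Y \to Z \to 0$ is an exact sequence of $\mathfrak{g}$-modules, where $\mathfrak{g}$ is the Virasoro algebra. If $X$ and $Z$ are objects of $\mathcal{W}$, then $Y$ is an object of $\mathcal{W}$.
   Context: $\mathfrak{g}$ is the Virasoro Lie algebra over $\mathbb{C}$, with basis $\{z, d_k \mid k \in \mathbb{Z}\}$ and bracket $[d_k,d_j]=(k-j)d_{k+j}+\delta_{j,-k}\frac{k^3-k}{12}z$, $[z,d_k]=0$. $\mathfrak{n}^+=\mathrm{span}_{\mathbb{C}}\{d_k \mid k>0\}$. The category $\mathcal{W}$ is the full subcategory of $\mathfrak{g}$-modules consisting of those $\mathfrak{g}$-modules $V$ on which $\mathfrak{n}^+$ acts locally finitely, i.e. $\dim_{\mathbb{C}} U(\mathfrak{n}^+)v<\infty$ for every $v\in V$. *)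

theory Defs
  imports Complex_Main "HOL-Library.Poly_Mapping" "HOL-Algebra.QuotRing"
begin

subsection \<open>Finitely supported functions as free vector spaces\<close>

definition pm_scale :: "'k::field \<Rightarrow> ('b \<Rightarrow>\<^sub>0 'k) \<Rightarrow> ('b \<Rightarrow>\<^sub>0 'k)" where
  "pm_scale c p = Poly_Mapping.map ((*) c) p"

definition lin_ext ::
    "('k::field \<Rightarrow> 'v::ab_group_add \<Rightarrow> 'v) \<Rightarrow> ('b \<Rightarrow> 'v) \<Rightarrow> ('b \<Rightarrow>\<^sub>0 'k) \<Rightarrow> 'v" where
  "lin_ext sc f p = (\<Sum>b\<in>Poly_Mapping.keys p. sc (Poly_Mapping.lookup p b) (f b))"

lemma lookup_pm_scale [simp]:
  "Poly_Mapping.lookup (pm_scale c p) b = c * Poly_Mapping.lookup p b"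
  by (simp add: pm_scale_def Poly_Mapping.map.rep_eq when_def)

lemma vector_space_pm_scale: "vector_space pm_scale"
  by unfold_locales (auto intro!: poly_mapping_eqI simp: lookup_add algebra_simps)

context vector_space
begin

lemma lin_ext_superset:
  assumes "finite A" "Poly_Mapping.keys p \<subseteq> A"
  shows "lin_ext scale f p = (\<Sum>b\<in>A. scale (Poly_Mapping.lookup p b) (f b))"
  unfolding lin_ext_def
  by (rule sum.mono_neutral_left) (use assms in \<open>auto simp: in_keys_iff\<close>)

lemma lin_ext_zero: "lin_ext scale f 0 = 0"
  by (simp add: lin_ext_def)

lemma lin_ext_add: "lin_ext scale f (p + q) = lin_ext scale f p + lin_ext scale f q"
proof -
  let ?A = "Poly_Mapping.keys p \<union> Poly_Mapping.keys q"
  have "Poly_Mapping.keys (p + q) \<subseteq> ?A" by (rule keys_add)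
  then show ?thesis
    by (simp add: lin_ext_superset[where A = ?A] lookup_add scale_left_distrib sum.distrib)
qed

lemma lin_ext_scale: "lin_ext scale f (pm_scale c p) = scale c (lin_ext scale f p)"
proof -
  have "Poly_Mapping.keys (pm_scale c p) \<subseteq> Poly_Mapping.keys p"
    by (auto simp: in_keys_iff)
  then show ?thesis
    by (simp add: lin_ext_superset[where A = "Poly_Mapping.keys p"] scale_sum_right)
qed

lemma lin_ext_single: "lin_ext scale f (Poly_Mapping.single b c) = scale c (f b)"
  by (simp add: lin_ext_def)

lemma lin_ext_uminus: "lin_ext scale f (- p) = - lin_ext scale f p"
  by (metis ab_group_add_class.ab_left_minus eq_neg_iff_add_eq_0 lin_ext_add lin_ext_zero)

lemma lin_ext_diff: "lin_ext scale f (p - q) = lin_ext scale f p - lin_ext scale f q"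
  using lin_ext_add[of f p "- q"] by (simp add: lin_ext_uminus)

end

lemma pm_induct [case_names zero add]:
  fixes p :: "'b \<Rightarrow>\<^sub>0 'k::monoid_add"
  assumes "P 0" "\<And>p b c. P p \<Longrightarrow> P (Poly_Mapping.single b c + p)"
  shows "P p"
proof (induction p rule: update_induct)
  case const
  then show ?case by (rule assms)
next
  case (update p b c)
  have "Poly_Mapping.update b c p = Poly_Mapping.single b c + p"
    using update by (intro poly_mapping_eqI) (auto simp: lookup_update lookup_add lookup_single when_def in_keys_iff)
  then show ?case using assms(2) update by metis
qed


subsection \<open>Lie algebras over the complex numbers and their modules\<close>

locale lie_algebra = vector_space scL
  for scL :: "complex \<Rightarrow> 'l::ab_group_add \<Rightarrow> 'l" +
  fixes br :: "'l \<Rightarrow> 'l \<Rightarrow> 'l"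
  assumes br_add_left: "br (x + y) u = br x u + br y u"
    and br_add_right: "br u (x + y) = br u x + br u y"
    and br_scale_left: "br (scL c x) u = scL c (br x u)"
    and br_scale_right: "br u (scL c x) = scL c (br u x)"
    and br_self: "br x x = 0"
    and jacobi: "br x (br y u) + br y (br u x) + br u (br x y) = 0"

definition (in lie_algebra) lie_subalgebra :: "'l set \<Rightarrow> bool" where
  "lie_subalgebra h \<longleftrightarrow> subspace h \<and> (\<forall>x\<in>h. \<forall>y\<in>h. br x y \<in> h)"

locale lie_module = L: lie_algebra scL br + V: vector_space scV
  for scL :: "complex \<Rightarrow> 'l::ab_group_add \<Rightarrow> 'l" and br :: "'l \<Rightarrow> 'l \<Rightarrow> 'l"
    and scV :: "complex \<Rightarrow> 'v::ab_group_add \<Rightarrow> 'v" +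
  fixes act :: "'l \<Rightarrow> 'v \<Rightarrow> 'v"
  assumes act_add_left: "act (x + y) v = act x v + act y v"
    and act_add_right: "act x (v + w) = act x v + act x w"
    and act_scale_left: "act (scL c x) v = scV c (act x v)"
    and act_scale_right: "act x (scV c v) = scV c (act x v)"
    and act_br: "act (br x y) v = act x (act y v) - act y (act x v)"

locale lie_module_hom = V: lie_module scL br scV actV + W: lie_module scL br scW actW +
    Vector_Spaces.linear scV scW f
  for scL :: "complex \<Rightarrow> 'l::ab_group_add \<Rightarrow> 'l" and br :: "'l \<Rightarrow> 'l \<Rightarrow> 'l"
    and scV :: "complex \<Rightarrow> 'v::ab_group_add \<Rightarrow> 'v" and actV :: "'l \<Rightarrow> 'v \<Rightarrow> 'v"
    and scW :: "complex \<Rightarrow> 'w::ab_group_add \<Rightarrow> 'w" and actW :: "'l \<Rightarrow> 'w \<Rightarrow> 'w"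
    and f :: "'v \<Rightarrow> 'w" +
  assumes hom_act: "f (actV x v) = actW x (f v)"

definition lie_short_exact where
  "lie_short_exact scL br scX actX scY actY scZ actZ f g \<longleftrightarrow>
     lie_module_hom scL br scX actX scY actY f \<and>
     lie_module_hom scL br scY actY scZ actZ g \<and>
     inj f \<and> range f = {y. g y = 0} \<and> surj g"


subsection \<open>The universal enveloping algebra\<close>

datatype 'l word = Word (letters: "'l list")

instantiation word :: (type) monoid_add
begin
definition zero_word :: "'l word" where "zero_word = Word []"
definition plus_word :: "'l word \<Rightarrow> 'l word \<Rightarrow> 'l word" where
  "plus_word u w = Word (letters u @ letters w)"
instance by standard (auto simp: zero_word_def plus_word_def)
end

text \<open>Words form the free monoid; it is written additively because the product of
  \<^typ>\<open>'b \<Rightarrow>\<^sub>0 'c\<close> is the convolution product over an additive monoid of exponents.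
  Thus \<^typ>\<open>'l word \<Rightarrow>\<^sub>0 complex\<close> is the free associative unital algebra on \<^typ>\<open>'l\<close>.\<close>

definition gen :: "'l \<Rightarrow> ('l word \<Rightarrow>\<^sub>0 complex)" where
  "gen x = Poly_Mapping.single (Word [x]) 1"

definition fconst :: "complex \<Rightarrow> ('l word \<Rightarrow>\<^sub>0 complex)" where
  "fconst c = Poly_Mapping.single 0 c"

definition free_alg :: "'l set \<Rightarrow> ('l word \<Rightarrow>\<^sub>0 complex) ring" where
  "free_alg h = \<lparr>carrier = {p. \<forall>w\<in>Poly_Mapping.keys p. set (letters w) \<subseteq> h},
     mult = (*), one = 1, zero = 0, add = (+)\<rparr>"

text \<open>The linearity relations turn the free algebra on the underlying set of a Lie algebra
  \<open>h\<close> into the tensor algebra of \<open>h\<close>, so that the quotient below is the usual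
  \<open>T(h) / (x \<otimes> y - y \<otimes> x - [x, y])\<close>. The constants lie in the free algebra, so ring ideals
  are automatically linear subspaces.\<close>

definition env_rels ::
    "(complex \<Rightarrow> 'l::ab_group_add \<Rightarrow> 'l) \<Rightarrow> ('l \<Rightarrow> 'l \<Rightarrow> 'l) \<Rightarrow> 'l set \<Rightarrow> ('l word \<Rightarrow>\<^sub>0 complex) set" where
  "env_rels scL br h =
     {gen (x + y) - gen x - gen y |x y. x \<in> h \<and> y \<in> h} \<union>
     {gen (scL c x) - fconst c * gen x |c x. x \<in> h} \<union>
     {gen x * gen y - gen y * gen x - gen (br x y) |x y. x \<in> h \<and> y \<in> h}"

definition env_ideal where
  "env_ideal scL br h = genideal (free_alg h) (env_rels scL br h)"

definition env_alg ::
    "(complex \<Rightarrow> 'l::ab_group_add \<Rightarrow> 'l) \<Rightarrow> ('l \<Rightarrow> 'l \<Rightarrow> 'l) \<Rightarrow> 'l set \<Rightarrow>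
     ('l word \<Rightarrow>\<^sub>0 complex) set ring" where
  "env_alg scL br h = free_alg h Quot env_ideal scL br h"

definition free_act ::
    "(complex \<Rightarrow> 'v::ab_group_add \<Rightarrow> 'v) \<Rightarrow> ('l \<Rightarrow> 'v \<Rightarrow> 'v) \<Rightarrow> ('l word \<Rightarrow>\<^sub>0 complex) \<Rightarrow> 'v \<Rightarrow> 'v" where
  "free_act scV act p v = lin_ext scV (\<lambda>w. foldr act (letters w) v) p"

text \<open>All representatives of an element of the enveloping algebra act alike, see
  \<open>env_act_coset\<close> below, so the image here is a singleton.\<close>

definition env_act ::
    "(complex \<Rightarrow> 'v::ab_group_add \<Rightarrow> 'v) \<Rightarrow> ('l \<Rightarrow> 'v \<Rightarrow> 'v) \<Rightarrow> ('l word \<Rightarrow>\<^sub>0 complex) set \<Rightarrow> 'v \<Rightarrow> 'v" where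
  "env_act scV act u v = the_elem ((\<lambda>p. free_act scV act p v) ` u)"

text \<open>The set \<open>U(h) v\<close>.\<close>

definition env_orbit where
  "env_orbit scL br h scV act v = (\<lambda>u. env_act scV act u v) ` carrier (env_alg scL br h)"

definition finite_dim_subspace :: "(complex \<Rightarrow> 'v::ab_group_add \<Rightarrow> 'v) \<Rightarrow> 'v set \<Rightarrow> bool" where
  "finite_dim_subspace sc S \<longleftrightarrow> (\<exists>B. finite B \<and> module.span sc B = S)"

definition acts_locally_finitely where
  "acts_locally_finitely scL br h scV act \<longleftrightarrow>
     (\<forall>v. finite_dim_subspace scV (env_orbit scL br h scV act v))"


subsection \<open>Well-definedness of the action of the enveloping algebra\<close>

lemma free_alg_simps [simp]:
  "mult (free_alg h) = (*)" "one (free_alg h) = 1" "zero (free_alg h) = 0"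
  "add (free_alg h) = (+)"
  "p \<in> carrier (free_alg h) \<longleftrightarrow> (\<forall>w\<in>Poly_Mapping.keys p. set (letters w) \<subseteq> h)"
  by (simp_all add: free_alg_def)

lemma ring_free_alg: "ring (free_alg h)"
proof (rule ringI)
  show "abelian_group (free_alg h)"
  proof (rule abelian_groupI)
    fix p q assume "p \<in> carrier (free_alg h)" "q \<in> carrier (free_alg h)"
    then show "p \<oplus>\<^bsub>free_alg h\<^esub> q \<in> carrier (free_alg h)"
      using keys_add[of p q] by auto
  next
    fix p assume p: "p \<in> carrier (free_alg h)"
    have "Poly_Mapping.keys (- p) = Poly_Mapping.keys p" by (auto simp: in_keys_iff)
    with p have "- p \<in> carrier (free_alg h)" by simp
    then show "\<exists>q\<in>carrier (free_alg h). q \<oplus>\<^bsub>free_alg h\<^esub> p = \<zero>\<^bsub>free_alg h\<^esub>"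
      by (rule bexI[rotated]) simp
  qed (simp_all add: add.assoc add.commute)
  show "Group.monoid (free_alg h)"
  proof (rule monoidI)
    fix p q assume "p \<in> carrier (free_alg h)" "q \<in> carrier (free_alg h)"
    then show "p \<otimes>\<^bsub>free_alg h\<^esub> q \<in> carrier (free_alg h)"
      using keys_mult[of p q] by (fastforce simp: plus_word_def)
  qed (simp_all add: zero_word_def mult.assoc)
qed (simp_all add: algebra_simps)

lemma (in lie_algebra) env_rels_subset:
  assumes "lie_subalgebra h"
  shows "env_rels scL br h \<subseteq> carrier (free_alg h)"
proof -
  interpret R: ring "free_alg h" by (rule ring_free_alg)
  have diff: "p - q \<in> carrier (free_alg h)"
    if "p \<in> carrier (free_alg h)" "q \<in> carrier (free_alg h)" for p q
    using that keys_add[of p "- q"] by (auto simp: in_keys_iff lookup_minus)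
  have mul: "p * q \<in> carrier (free_alg h)"
    if "p \<in> carrier (free_alg h)" "q \<in> carrier (free_alg h)" for p q
    using R.m_closed[OF that] by simp
  have gen: "gen x \<in> carrier (free_alg h)" if "x \<in> h" for x
    using that by (simp add: gen_def)
  have fconst: "fconst c \<in> carrier (free_alg h)" for c
    by (simp add: fconst_def zero_word_def)
  have cl: "x + y \<in> h" "br x y \<in> h" "scL c x \<in> h" if "x \<in> h" "y \<in> h" for x y c
    using assms that by (auto simp: lie_subalgebra_def subspace_def)
  show ?thesis
    unfolding env_rels_def by (blast intro: diff mul gen fconst cl)
qed

context lie_module
begin

lemma foldr_act_add: "foldr act xs (v + w) = foldr act xs v + foldr act xs w"
  by (induction xs) (simp_all add: act_add_right)

lemma foldr_act_scale: "foldr act xs (scV c v) = scV c (foldr act xs v)"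
  by (induction xs) (simp_all add: act_scale_right)

lemma free_act_add_left: "free_act scV act (p + q) v = free_act scV act p v + free_act scV act q v"
  by (simp add: free_act_def V.lin_ext_add)

lemma free_act_diff_left: "free_act scV act (p - q) v = free_act scV act p v - free_act scV act q v"
  by (simp add: free_act_def V.lin_ext_diff)

lemma free_act_uminus_left: "free_act scV act (- p) v = - free_act scV act p v"
  by (simp add: free_act_def V.lin_ext_uminus)

lemma free_act_zero_left: "free_act scV act 0 v = 0"
  by (simp add: free_act_def V.lin_ext_zero)

lemma free_act_single:
  "free_act scV act (Poly_Mapping.single w c) v = scV c (foldr act (letters w) v)"
  by (simp add: free_act_def V.lin_ext_single)

lemma free_act_add_right: "free_act scV act p (v + w) = free_act scV act p v + free_act scV act p w"
  by (simp add: free_act_def lin_ext_def foldr_act_add V.scale_right_distrib sum.distrib)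

lemma free_act_scale_right: "free_act scV act p (scV c v) = scV c (free_act scV act p v)"
  by (simp add: free_act_def lin_ext_def foldr_act_scale V.scale_sum_right mult.commute)

lemma free_act_zero_right: "free_act scV act p 0 = 0"
  using free_act_scale_right[of p 0 0] by simp

lemma free_act_mult: "free_act scV act (p * q) v = free_act scV act p (free_act scV act q v)"
proof (induction p rule: pm_induct)
  case zero
  then show ?case by (simp add: free_act_zero_left)
next
  case (add p w c)
  have "free_act scV act (Poly_Mapping.single w c * q) v
          = free_act scV act (Poly_Mapping.single w c) (free_act scV act q v)"
  proof (induction q rule: pm_induct)
    case zero
    then show ?case by (simp add: free_act_zero_left free_act_zero_right)
  next
    case (add q u d)
    then show ?case
      by (simp add: algebra_simps free_act_add_left free_act_add_right mult_single free_act_single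
          plus_word_def foldr_act_scale)
  qed
  with add show ?case by (simp add: distrib_right free_act_add_left)
qed

lemma free_act_env_ideal:
  assumes "L.lie_subalgebra h" "p \<in> env_ideal scL br h"
  shows "free_act scV act p v = 0"
proof -
  interpret R: ring "free_alg h" by (rule ring_free_alg)
  let ?K = "{p \<in> carrier (free_alg h). \<forall>v. free_act scV act p v = 0}"
  have "ideal ?K (free_alg h)"
  proof (rule idealI)
    show "subgroup ?K (add_monoid (free_alg h))"
    proof (rule R.add.subgroupI)
      show "?K \<subseteq> carrier (free_alg h)" by blast
      have "0 \<in> ?K" by (simp add: free_act_zero_left)
      then show "?K \<noteq> {}" by blast
      fix p assume p: "p \<in> ?K"
      then have car: "p \<in> carrier (free_alg h)" "- p \<in> carrier (free_alg h)"
        by (auto simp: in_keys_iff)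
      then have "\<ominus>\<^bsub>free_alg h\<^esub> p = - p"
        by (intro R.minus_equality) simp_all
      with p car show "\<ominus>\<^bsub>free_alg h\<^esub> p \<in> ?K"
        by (simp add: free_act_uminus_left)
    next
      fix p q assume "p \<in> ?K" "q \<in> ?K"
      then have "p \<oplus>\<^bsub>free_alg h\<^esub> q \<in> carrier (free_alg h)"
        and "\<forall>v. free_act scV act (p + q) v = 0"
        by (blast intro: R.a_closed, simp add: free_act_add_left)
      then show "p \<oplus>\<^bsub>free_alg h\<^esub> q \<in> ?K"
        by (simp del: free_alg_simps(5))
    qed
  next
    fix p q assume "p \<in> ?K" "q \<in> carrier (free_alg h)"
    then have "q \<otimes>\<^bsub>free_alg h\<^esub> p \<in> carrier (free_alg h)"
        "p \<otimes>\<^bsub>free_alg h\<^esub> q \<in> carrier (free_alg h)"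
      and "\<forall>v. free_act scV act (q * p) v = 0" "\<forall>v. free_act scV act (p * q) v = 0"
      by (blast intro: R.m_closed, blast intro: R.m_closed,
          simp_all add: free_act_mult free_act_zero_right)
    then show "q \<otimes>\<^bsub>free_alg h\<^esub> p \<in> ?K" "p \<otimes>\<^bsub>free_alg h\<^esub> q \<in> ?K"
      by (simp_all del: free_alg_simps(5))
  qed (rule ring_free_alg)
  moreover have "free_act scV act r v = 0" if "r \<in> env_rels scL br h" for r v
    using that
    by (auto simp: env_rels_def gen_def fconst_def mult_single free_act_diff_left
        free_act_single plus_word_def zero_word_def act_add_left act_scale_left act_br)
  then have "env_rels scL br h \<subseteq> ?K"
    using L.env_rels_subset[OF assms(1)] by blast
  ultimately have "env_ideal scL br h \<subseteq> ?K"
    unfolding env_ideal_def by (rule R.genideal_minimal)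
  with assms(2) show ?thesis by blast
qed

lemma env_act_coset:
  assumes "L.lie_subalgebra h"
  shows "env_act scV act (env_ideal scL br h +>\<^bsub>free_alg h\<^esub> p) v = free_act scV act p v"
proof -
  interpret R: ring "free_alg h" by (rule ring_free_alg)
  interpret I: ideal "env_ideal scL br h" "free_alg h"
    unfolding env_ideal_def using L.env_rels_subset[OF assms] by (rule R.genideal_ideal)
  have "0 \<in> env_ideal scL br h" using I.zero_closed by simp
  moreover have "free_act scV act (q + p) v = free_act scV act p v"
    if "q \<in> env_ideal scL br h" for q
    using free_act_env_ideal[OF assms that] by (simp add: free_act_add_left)
  ultimately have "(\<lambda>p. free_act scV act p v) ` (env_ideal scL br h +>\<^bsub>free_alg h\<^esub> p)
      = {free_act scV act p v}"
    unfolding a_r_coset_def' by (auto simp: image_iff)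
  then show ?thesis by (simp add: env_act_def)
qed

lemma env_orbit_eq:
  assumes "L.lie_subalgebra h"
  shows "env_orbit scL br h scV act v = (\<lambda>p. free_act scV act p v) ` carrier (free_alg h)"
  unfolding env_orbit_def env_alg_def FactRing_def A_RCOSETS_def'
  by (auto simp: env_act_coset[OF assms] image_iff simp del: free_alg_simps(5))

end


subsection \<open>The Virasoro algebra\<close>

datatype vir_basis = Vz | Vd int

type_synonym vir = "vir_basis \<Rightarrow>\<^sub>0 complex"

fun vir_basis_bracket :: "vir_basis \<Rightarrow> vir_basis \<Rightarrow> vir" where
  "vir_basis_bracket (Vd k) (Vd j) =
     Poly_Mapping.single (Vd (k + j)) (of_int (k - j)) +
     (if j = - k then Poly_Mapping.single Vz (of_int (k ^ 3 - k) / 12) else 0)"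
| "vir_basis_bracket _ _ = 0"

definition vir_bracket :: "vir \<Rightarrow> vir \<Rightarrow> vir" where
  "vir_bracket x y = lin_ext pm_scale (\<lambda>a. lin_ext pm_scale (vir_basis_bracket a) y) x"

definition vir_n_plus :: "vir set" where
  "vir_n_plus = module.span pm_scale {Poly_Mapping.single (Vd k) 1 |k. k > 0}"

abbreviation vir_module ::
    "(complex \<Rightarrow> 'v::ab_group_add \<Rightarrow> 'v) \<Rightarrow> (vir \<Rightarrow> 'v \<Rightarrow> 'v) \<Rightarrow> bool" where
  "vir_module \<equiv> lie_module pm_scale vir_bracket"

abbreviation vir_short_exact where
  "vir_short_exact \<equiv> lie_short_exact pm_scale vir_bracket"

definition in_cat_W ::
    "(complex \<Rightarrow> 'v::ab_group_add \<Rightarrow> 'v) \<Rightarrow> (vir \<Rightarrow> 'v \<Rightarrow> 'v) \<Rightarrow> bool" where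
  "in_cat_W sc act \<longleftrightarrow>
     vir_module sc act \<and> acts_locally_finitely pm_scale vir_bracket vir_n_plus sc act"

interpretation PM: vector_space "pm_scale :: complex \<Rightarrow> ('b \<Rightarrow>\<^sub>0 complex) \<Rightarrow> _"
  by (rule vector_space_pm_scale)

lemma vir_bracket_add_left: "vir_bracket (x + y) u = vir_bracket x u + vir_bracket y u"
  by (simp add: vir_bracket_def PM.lin_ext_add)

lemma vir_bracket_scale_left: "vir_bracket (pm_scale c x) u = pm_scale c (vir_bracket x u)"
  by (simp add: vir_bracket_def PM.lin_ext_scale)

lemma vir_bracket_add_right: "vir_bracket u (x + y) = vir_bracket u x + vir_bracket u y"
  by (simp add: vir_bracket_def PM.lin_ext_add)
    (simp add: lin_ext_def PM.scale_right_distrib sum.distrib)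

lemma vir_bracket_scale_right: "vir_bracket u (pm_scale c x) = pm_scale c (vir_bracket u x)"
  by (simp add: vir_bracket_def PM.lin_ext_scale)
    (simp add: lin_ext_def PM.scale_sum_right mult.left_commute)

lemma vir_bracket_zero [simp]: "vir_bracket 0 x = 0" "vir_bracket x 0 = 0"
  using vir_bracket_scale_left[of 0 0 x] vir_bracket_scale_right[of x 0 0] by simp_all

lemma vir_bracket_basis:
  "vir_bracket (Poly_Mapping.single a 1) (Poly_Mapping.single b 1) = vir_basis_bracket a b"
  by (simp add: vir_bracket_def PM.lin_ext_single)

lemma single_eq_scale: "Poly_Mapping.single b c = pm_scale c (Poly_Mapping.single b 1)"
  by (rule poly_mapping_eqI) (simp add: lookup_single when_def)

lemma vir_bracket_anti: "vir_bracket x y = - vir_bracket y x"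
proof -
  have basis: "vir_bracket (Poly_Mapping.single a 1) (Poly_Mapping.single b 1)
      = - vir_bracket (Poly_Mapping.single b 1) (Poly_Mapping.single a 1)" for a b
    unfolding vir_bracket_basis
    by (cases a; cases b)
      (auto intro!: poly_mapping_eqI simp: lookup_add lookup_minus lookup_single when_def field_simps)
  have 1: "vir_bracket (Poly_Mapping.single a 1) y
      = - vir_bracket y (Poly_Mapping.single a 1)" for a
  proof (induction y rule: pm_induct)
    case (add y b c)
    then show ?case
      using basis[of a b]
      by (simp add: single_eq_scale[of b c] vir_bracket_add_left vir_bracket_add_right
          vir_bracket_scale_left vir_bracket_scale_right)
  qed simp
  show ?thesis
  proof (induction x rule: pm_induct)
    case (add x a c)
    then show ?case
      using 1[of a]
      by (simp add: single_eq_scale[of a c] vir_bracket_add_left vir_bracket_add_right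
          vir_bracket_scale_left vir_bracket_scale_right)
  qed simp
qed

lemma vir_bracket_z [simp]:
  "vir_bracket (Poly_Mapping.single Vz c) x = 0" "vir_bracket x (Poly_Mapping.single Vz c) = 0"
proof -
  have "vir_basis_bracket Vz b = 0" for b by simp
  then have "vir_bracket (Poly_Mapping.single Vz c) x = 0" for x
    by (simp add: vir_bracket_def PM.lin_ext_single) (simp add: lin_ext_def)
  then show "vir_bracket (Poly_Mapping.single Vz c) x = 0"
    "vir_bracket x (Poly_Mapping.single Vz c) = 0"
    using vir_bracket_anti[of x] by simp_all
qed

lemma vir_bracket_d:
  "vir_bracket (Poly_Mapping.single (Vd k) a) (Poly_Mapping.single (Vd j) b) =
     Poly_Mapping.single (Vd (k + j)) (a * b * of_int (k - j)) +
     Poly_Mapping.single Vz (if j = - k then a * b * (of_int (k ^ 3 - k) / 12) else 0)"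
  by (rule poly_mapping_eqI)
    (auto simp: vir_bracket_def PM.lin_ext_single lookup_add lookup_single when_def algebra_simps)

lemma vir_jacobi_basis:
  fixes a b c :: vir_basis
  defines "e \<equiv> \<lambda>a. Poly_Mapping.single a (1::complex)"
  shows "vir_bracket (e a) (vir_bracket (e b) (e c)) + vir_bracket (e b) (vir_bracket (e c) (e a))
     + vir_bracket (e c) (vir_bracket (e a) (e b)) = 0"
proof (cases "a = Vz \<or> b = Vz \<or> c = Vz")
  case True
  then show ?thesis by (auto simp: e_def)
next
  case False
  then obtain k j l where abc: "a = Vd k" "b = Vd j" "c = Vd l"
    using vir_basis.exhaust by metis
  show ?thesis
  proof (cases "k + j + l = 0")
    case False
    then show ?thesis
      unfolding abc e_def
      by (intro poly_mapping_eqI)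
        (auto simp: vir_bracket_d vir_bracket_add_right lookup_add lookup_single when_def
          algebra_simps)
  next
    case True
    then have l: "l = - k - j" by simp
    show ?thesis
      unfolding abc e_def l
      by (intro poly_mapping_eqI)
        (auto simp: vir_bracket_d vir_bracket_add_right lookup_add lookup_single when_def
          field_simps power3_eq_cube)
  qed
qed

lemma vir_jacobi:
  "vir_bracket x (vir_bracket y u) + vir_bracket y (vir_bracket u x)
     + vir_bracket u (vir_bracket x y) = 0"
proof -
  let ?J = "\<lambda>x y u. vir_bracket x (vir_bracket y u) + vir_bracket y (vir_bracket u x)
     + vir_bracket u (vir_bracket x y)"
  note lin = vir_bracket_add_left vir_bracket_add_right vir_bracket_scale_left
    vir_bracket_scale_right
  have J: "?J (pm_scale c x + x') y u = pm_scale c (?J x y u) + ?J x' y u" for c x x' y u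
    by (simp add: lin PM.scale_right_distrib)
  have cyc: "?J x y u = ?J y u x" for x y u by simp
  have step: "?J x y u = 0" if "\<And>a. ?J (Poly_Mapping.single a 1) y u = 0" for x y u
  proof (induction x rule: pm_induct)
    case (add x a c)
    then show ?case
      unfolding single_eq_scale[of a c] J that by simp
  qed simp
  have two: "?J (Poly_Mapping.single a 1) (Poly_Mapping.single b 1) u = 0" for a b u
  proof -
    have "?J u (Poly_Mapping.single a 1) (Poly_Mapping.single b 1) = 0"
      by (rule step) (rule vir_jacobi_basis)
    then show ?thesis by (rule trans[OF cyc[symmetric]])
  qed
  have "?J (Poly_Mapping.single a 1) y u = 0" for a y u
  proof -
    have "?J y u (Poly_Mapping.single a 1) = 0"
    proof (rule step)
      show "?J (Poly_Mapping.single b 1) u (Poly_Mapping.single a 1) = 0" for b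
        using two[of a b u] by (rule trans[OF cyc[symmetric]])
    qed
    then show ?thesis by (rule trans[OF cyc])
  qed
  then show ?thesis by (rule step)
qed

interpretation Vir: lie_algebra pm_scale vir_bracket
proof unfold_locales
  show "vir_bracket x x = 0" for x
  proof (rule poly_mapping_eqI)
    fix b
    have "Poly_Mapping.lookup (vir_bracket x x) b = - Poly_Mapping.lookup (vir_bracket x x) b"
      using arg_cong[OF vir_bracket_anti[of x x], of "\<lambda>p. Poly_Mapping.lookup p b"] by simp
    then show "Poly_Mapping.lookup (vir_bracket x x) b = Poly_Mapping.lookup 0 b" by simp
  qed
qed (simp_all add: vir_bracket_add_left vir_bracket_add_right vir_bracket_scale_left
    vir_bracket_scale_right vir_jacobi)

lemma lie_subalgebra_vir_n_plus: "Vir.lie_subalgebra vir_n_plus"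
proof -
  let ?D = "{Poly_Mapping.single (Vd k) (1::complex) |k. k > 0}"
  have base: "vir_bracket x y \<in> vir_n_plus" if x: "x \<in> ?D" and y: "y \<in> ?D" for x y
  proof -
    obtain k j where kj: "x = Poly_Mapping.single (Vd k) 1" "y = Poly_Mapping.single (Vd j) 1"
      "k > 0" "j > 0"
      using x y by blast
    then have "vir_bracket x y
        = pm_scale (of_int (k - j)) (Poly_Mapping.single (Vd (k + j)) 1)"
      by (simp add: vir_bracket_d flip: single_eq_scale)
    moreover have "Poly_Mapping.single (Vd (k + j)) 1 \<in> ?D"
      using kj by (intro CollectI exI[of _ "k + j"]) simp
    ultimately show ?thesis
      unfolding vir_n_plus_def by (simp only:) (intro PM.span_scale PM.span_base)
  qed
  have sub: "PM.subspace vir_n_plus"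
    unfolding vir_n_plus_def by (rule PM.subspace_span)
  have left: "vir_bracket x y \<in> vir_n_plus" if x: "x \<in> ?D" and y: "y \<in> vir_n_plus" for x y
    using y unfolding vir_n_plus_def
  proof (induction rule: PM.span_induct_alt)
    case base
    then show ?case by (simp add: PM.span_zero)
  next
    case (step c u y)
    then show ?case
      using base[OF x step(1)] unfolding vir_n_plus_def
      by (simp add: vir_bracket_add_right vir_bracket_scale_right PM.span_add PM.span_scale)
  qed
  have "vir_bracket x y \<in> vir_n_plus" if x: "x \<in> vir_n_plus" and y: "y \<in> vir_n_plus" for x y
    using x unfolding vir_n_plus_def
  proof (induction rule: PM.span_induct_alt)
    case base
    then show ?case by (simp add: PM.span_zero)
  next
    case (step c u x)
    then show ?case
      using left[OF step(1) y] unfolding vir_n_plus_def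
      by (simp add: vir_bracket_add_left vir_bracket_scale_left PM.span_add PM.span_scale)
  qed
  with sub show ?thesis by (simp add: Vir.lie_subalgebra_def)
qed

end

theory Submission
  imports Defs
begin

text \<open>
  The point is that \<open>n\<^sup>+\<close> is generated, as a Lie algebra, by the two elements \<open>d\<^sub>1\<close> and \<open>d\<^sub>2\<close>. Being
  locally finite means that every vector lies in a finite-dimensional stable subspace, and whether
  a subspace is stable can be tested on Lie generators, because the stabilizer of a
  subspace is a Lie subalgebra.

  Given \<open>y \<in> Y\<close>, a finite-dimensional stable subspace of \<open>Z\<close> containing the image of \<open>y\<close> lifts to
  a finite-dimensional \<open>W \<subseteq> Y\<close> containing \<open>y\<close>. It need not be stable, but for
  a generator \<open>s\<close> and a spanning vector \<open>w\<close> of \<open>W\<close> the vector \<open>s w\<close> differs from an element of \<open>W\<close>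
  by an element of \<open>X\<close>. There are only finitely many such errors, because there are finitely many
  pairs \<open>(s, w)\<close>; as \<open>X\<close> is locally finite, they all lie in one finite-dimensional
  stable \<open>X' \<subseteq> X\<close>. Then \<open>W + X'\<close> is finite-dimensional and stable under the generators, hence
  stable under \<open>n\<^sup>+\<close>.

  In terms of \<open>U(n\<^sup>+)\<close> this is the fact that a left ideal of finite codimension in a finitely
  generated algebra is finitely generated.
\<close>

context lie_module
begin

lemma act_zero_left: "act 0 v = 0"
  using act_scale_left[of 0 0 v] by simp

lemma act_zero_right: "act x 0 = 0"
  using act_scale_right[of x 0 0] by simp

lemma act_span_closed:
  assumes "\<And>b. b \<in> B \<Longrightarrow> act x b \<in> V.span B" and "v \<in> V.span B"
  shows "act x v \<in> V.span B"
  using assms(2)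
proof (induction rule: V.span_induct_alt)
  case base
  then show ?case by (simp add: act_zero_right V.span_zero)
next
  case (step c b v)
  then show ?case
    using assms(1)[of b] by (simp add: act_add_right act_scale_right V.span_add V.span_scale)
qed

text \<open>Together with a generating set of a Lie algebra, this reduces stability of a subspace to
  the generators.\<close>

lemma lie_subalgebra_stabilizer:
  assumes "V.subspace W"
  shows "L.lie_subalgebra {x. \<forall>w\<in>W. act x w \<in> W}"
  using assms
  by (auto simp: L.lie_subalgebra_def L.subspace_def act_zero_left act_add_left act_scale_left
      act_br V.subspace_0 V.subspace_add V.subspace_scale V.subspace_diff)

lemma subspace_env_orbit:
  assumes "L.lie_subalgebra h"
  shows "V.subspace (env_orbit scL br h scV act v)"
proof -
  interpret R: ring "free_alg h" by (rule ring_free_alg)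
  let ?O = "(\<lambda>p. free_act scV act p v) ` carrier (free_alg h)"
  have "0 \<in> ?O"
    using R.zero_closed by (intro image_eqI[of _ _ 0]) (simp_all add: free_act_zero_left)
  moreover have "free_act scV act p v + free_act scV act q v \<in> ?O"
    if "p \<in> carrier (free_alg h)" "q \<in> carrier (free_alg h)" for p q
    using R.a_closed[OF that] by (intro image_eqI[of _ _ "p + q"]) (simp_all add: free_act_add_left)
  moreover have "scV c (free_act scV act p v) \<in> ?O" if p: "p \<in> carrier (free_alg h)" for c p
  proof (rule image_eqI)
    show "scV c (free_act scV act p v) = free_act scV act (fconst c * p) v"
      by (simp add: free_act_mult fconst_def free_act_single zero_word_def)
    have "fconst c \<in> carrier (free_alg h)"
      by (simp add: fconst_def zero_word_def)
    then show "fconst c * p \<in> carrier (free_alg h)"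
      using R.m_closed[OF _ p] by simp
  qed
  ultimately show ?thesis
    unfolding env_orbit_eq[OF assms] V.subspace_def by (auto simp del: free_alg_simps(5))
qed

lemma env_orbit_self:
  assumes "L.lie_subalgebra h"
  shows "v \<in> env_orbit scL br h scV act v"
  unfolding env_orbit_eq[OF assms]
  by (rule image_eqI[of _ _ "Poly_Mapping.single 0 1"])
    (simp_all add: free_act_single zero_word_def)

lemma act_env_orbit:
  assumes "L.lie_subalgebra h" "x \<in> h" "w \<in> env_orbit scL br h scV act v"
  shows "act x w \<in> env_orbit scL br h scV act v"
proof -
  interpret R: ring "free_alg h" by (rule ring_free_alg)
  obtain p where p: "p \<in> carrier (free_alg h)" "w = free_act scV act p v"
    using assms(3) unfolding env_orbit_eq[OF assms(1)] by blast
  have "gen x \<in> carrier (free_alg h)"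
    using assms(2) by (simp add: gen_def)
  then have "gen x * p \<in> carrier (free_alg h)"
    using R.m_closed[OF _ p(1)] by simp
  moreover have "act x w = free_act scV act (gen x * p) v"
    by (simp add: p(2) free_act_mult gen_def free_act_single)
  ultimately show ?thesis
    unfolding env_orbit_eq[OF assms(1)] by blast
qed

lemma env_orbit_subset:
  assumes "L.lie_subalgebra h" "V.subspace W" "v \<in> W"
    and stable: "\<And>x w. x \<in> h \<Longrightarrow> w \<in> W \<Longrightarrow> act x w \<in> W"
  shows "env_orbit scL br h scV act v \<subseteq> W"
proof -
  have word: "foldr act xs v \<in> W" if "set xs \<subseteq> h" for xs
    using that by (induction xs) (auto simp: assms(3) stable)
  have "free_act scV act p v \<in> W" if "p \<in> carrier (free_alg h)" for p
    unfolding free_act_def lin_ext_def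
    using that by (auto intro!: V.subspace_sum[OF assms(2)] V.subspace_scale[OF assms(2)] word)
  then show ?thesis
    unfolding env_orbit_eq[OF assms(1)] by blast
qed

text \<open>Being contained in a finite-dimensional stable subspace is preserved when finitely many
  vectors are taken together, since a sum of stable subspaces is stable. The finite set of
  vectors is what the treatment of extensions needs.\<close>

lemma acts_locally_finitelyD:
  assumes lf: "acts_locally_finitely scL br h scV act" and h: "L.lie_subalgebra h" and "finite T"
  obtains B where "finite B" "T \<subseteq> V.span B"
    "\<And>x v. x \<in> h \<Longrightarrow> v \<in> V.span B \<Longrightarrow> act x v \<in> V.span B"
proof -
  have "\<forall>v. \<exists>B. finite B \<and> V.span B = env_orbit scL br h scV act v"
    using lf by (simp add: acts_locally_finitely_def finite_dim_subspace_def)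
  then obtain b where fin: "finite (b v)" and b: "V.span (b v) = env_orbit scL br h scV act v" for v
    by metis
  let ?B = "\<Union>v\<in>T. b v"
  have sub: "V.span (b v) \<subseteq> V.span ?B" if "v \<in> T" for v
    using that by (intro V.span_mono) blast
  show thesis
  proof (rule that[of ?B])
    show "finite ?B"
      using fin \<open>finite T\<close> by blast
    show "T \<subseteq> V.span ?B"
      using sub env_orbit_self[OF h] unfolding b by blast
    fix x v assume x: "x \<in> h" and v: "v \<in> V.span ?B"
    have "act x w \<in> V.span ?B" if w: "w \<in> ?B" for w
    proof -
      obtain t where t: "t \<in> T" "w \<in> V.span (b t)"
        using w V.span_base by blast
      then have "act x w \<in> V.span (b t)"
        using act_env_orbit[OF h x] unfolding b by blast
      then show ?thesis using sub[OF t(1)] by blast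
    qed
    then show "act x v \<in> V.span ?B"
      using v by (rule act_span_closed)
  qed
qed

lemma acts_locally_finitelyI:
  assumes h: "L.lie_subalgebra h"
    and ex: "\<And>v. \<exists>B. finite B \<and> v \<in> V.span B \<and>
      (\<forall>x\<in>h. \<forall>w\<in>V.span B. act x w \<in> V.span B)"
  shows "acts_locally_finitely scL br h scV act"
  unfolding acts_locally_finitely_def finite_dim_subspace_def
proof
  fix v
  let ?O = "env_orbit scL br h scV act v"
  obtain B where B: "finite B" "v \<in> V.span B" "\<forall>x\<in>h. \<forall>w\<in>V.span B. act x w \<in> V.span B"
    using ex by blast
  then have sub: "?O \<subseteq> V.span B"
    by (intro env_orbit_subset[OF h]) auto
  obtain C where C: "C \<subseteq> ?O" "V.independent C" "?O \<subseteq> V.span C"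
    using V.maximal_independent_subset[of ?O] by blast
  have "finite C"
    using V.independent_span_bound[OF B(1) C(2)] C(1) sub by blast
  moreover have "V.span C = ?O"
    using C(1,3) subspace_env_orbit[OF h] by (rule V.span_subspace)
  ultimately show "\<exists>B. finite B \<and> V.span B = ?O" by blast
qed

end

text \<open>Finite generation is what makes the set of errors \<open>s w - w'\<close> finite. The hypothesis
  on \<open>S\<close> says that \<open>S\<close> generates \<open>h\<close> as a Lie algebra, without naming the
  generated subalgebra.\<close>

lemma acts_locally_finitely_extension:
  assumes exact: "lie_short_exact scL br scX actX scY actY scZ actZ f g"
    and h: "lie_algebra.lie_subalgebra scL br h"
    and S: "finite S" "S \<subseteq> h"
    and generates: "\<And>k. lie_algebra.lie_subalgebra scL br k \<Longrightarrow> S \<subseteq> k \<Longrightarrow> h \<subseteq> k"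
    and X: "acts_locally_finitely scL br h scX actX"
    and Z: "acts_locally_finitely scL br h scZ actZ"
  shows "acts_locally_finitely scL br h scY actY"
proof -
  interpret F: lie_module_hom scL br scX actX scY actY f
    using exact by (simp add: lie_short_exact_def)
  interpret G: lie_module_hom scL br scY actY scZ actZ g
    using exact by (simp add: lie_short_exact_def)
  have ker: "range f = {y. g y = 0}" and surj: "surj g"
    using exact by (simp_all add: lie_short_exact_def)
  show ?thesis
  proof (rule F.W.acts_locally_finitelyI[OF h])
    fix y
    obtain C where C: "finite C" "{g y} \<subseteq> G.W.V.span C"
      and C_stable: "\<And>x v. x \<in> h \<Longrightarrow> v \<in> G.W.V.span C \<Longrightarrow> actZ x v \<in> G.W.V.span C"
      by (rule G.W.acts_locally_finitelyD[OF Z h, of "{g y}"]) auto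
    define W where "W = insert y (inv_into UNIV g ` C)"
    have fin_W: "finite W" using C(1) by (simp add: W_def)
    have gW: "g ` W = insert (g y) C"
      using surj by (simp add: W_def image_image surj_f_inv_f)
    have lift: "G.W.V.span C \<subseteq> g ` F.W.V.span W"
      unfolding G.span_image[symmetric] gW by (rule G.W.V.span_mono) blast
    have "\<exists>x. actY s w - f x \<in> F.W.V.span W" if "s \<in> S" "w \<in> W" for s w
    proof -
      have "g w \<in> G.W.V.span C"
        using gW C(2) \<open>w \<in> W\<close> G.W.V.span_base by blast
      then have "g (actY s w) \<in> G.W.V.span C"
        using C_stable S(2) \<open>s \<in> S\<close> by (auto simp: G.hom_act)
      then obtain w' where w': "w' \<in> F.W.V.span W" "g (actY s w) = g w'"
        using lift by blast
      then have "actY s w - w' \<in> range f"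
        by (simp add: ker G.diff)
      then obtain x where "f x = actY s w - w'" by (metis rangeE)
      then show ?thesis using w'(1) by (intro exI[of _ x]) simp
    qed
    \<comment> \<open>\<open>e s w\<close> is the component in \<open>X\<close> by which \<open>s w\<close> leaves the span of \<open>W\<close>; the set \<open>D\<close> then spans
      a stable subspace of \<open>X\<close> absorbing all of these.\<close>
    then obtain e where e: "actY s w - f (e s w) \<in> F.W.V.span W" if "s \<in> S" "w \<in> W" for s w
      by metis
    obtain D where D: "finite D" "(\<lambda>(s, w). e s w) ` (S \<times> W) \<subseteq> F.V.V.span D"
      and D_stable: "\<And>x v. x \<in> h \<Longrightarrow> v \<in> F.V.V.span D \<Longrightarrow> actX x v \<in> F.V.V.span D"
      by (rule F.V.acts_locally_finitelyD[OF X h, of "(\<lambda>(s, w). e s w) ` (S \<times> W)"])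
        (use S(1) fin_W in auto)
    let ?B = "W \<union> f ` D"
    have W_sub: "F.W.V.span W \<subseteq> F.W.V.span ?B"
      by (rule F.W.V.span_mono) blast
    have D_sub: "f x \<in> F.W.V.span ?B" if "x \<in> F.V.V.span D" for x
    proof -
      have "f x \<in> F.W.V.span (f ` D)"
        using that unfolding F.span_image by blast
      then show ?thesis using F.W.V.span_mono[of "f ` D" ?B] by blast
    qed
    have "actY s b \<in> F.W.V.span ?B" if s: "s \<in> S" and b: "b \<in> ?B" for s b
      using b
    proof
      assume w: "b \<in> W"
      have "f (e s b) \<in> F.W.V.span ?B"
        using D(2) s w by (intro D_sub) auto
      then have "(actY s b - f (e s b)) + f (e s b) \<in> F.W.V.span ?B"
        using e[OF s w] W_sub by (intro F.W.V.span_add) auto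
      then show ?thesis by simp
    next
      assume "b \<in> f ` D"
      then obtain d where d: "d \<in> D" "b = f d" by blast
      then have "actX s d \<in> F.V.V.span D"
        using S(2) s by (auto intro: D_stable F.V.V.span_base)
      then have "f (actX s d) \<in> F.W.V.span ?B"
        by (rule D_sub)
      then show ?thesis by (simp add: d(2) F.hom_act)
    qed
    then have "S \<subseteq> {x. \<forall>w\<in>F.W.V.span ?B. actY x w \<in> F.W.V.span ?B}"
      using F.W.act_span_closed[of ?B] by blast
    then have "h \<subseteq> {x. \<forall>w\<in>F.W.V.span ?B. actY x w \<in> F.W.V.span ?B}"
      by (rule generates[OF F.W.lie_subalgebra_stabilizer[OF F.W.V.subspace_span]])
    moreover have "finite ?B" using fin_W D(1) by simp
    moreover have "y \<in> F.W.V.span ?B"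
      by (rule F.W.V.span_base) (simp add: W_def)
    ultimately show "\<exists>B. finite B \<and> y \<in> F.W.V.span B \<and>
        (\<forall>x\<in>h. \<forall>w\<in>F.W.V.span B. actY x w \<in> F.W.V.span B)"
      by blast
  qed
qed

text \<open>Bracketing with \<open>d\<^sub>1\<close> raises the degree: \<open>[d\<^sub>k, d\<^sub>1] = (k - 1) d\<^bsub>k+1\<^esub>\<close>. The coefficient
  vanishes exactly for \<open>k = 1\<close>, which is why \<open>d\<^sub>2\<close> is needed as a second generator.\<close>

lemma vir_n_plus_generated:
  assumes k: "Vir.lie_subalgebra k"
    and gens: "{Poly_Mapping.single (Vd 1) 1, Poly_Mapping.single (Vd 2) 1} \<subseteq> k"
  shows "vir_n_plus \<subseteq> k"
proof -
  have sub: "PM.subspace k" and br: "\<And>x y. x \<in> k \<Longrightarrow> y \<in> k \<Longrightarrow> vir_bracket x y \<in> k"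
    using k by (auto simp: Vir.lie_subalgebra_def)
  have ge2: "Poly_Mapping.single (Vd j) 1 \<in> k" if "j \<ge> 2" for j
    using that
  proof (induction j rule: int_ge_induct)
    case base
    then show ?case using gens by simp
  next
    case (step j)
    have "vir_bracket (Poly_Mapping.single (Vd j) 1) (Poly_Mapping.single (Vd 1) 1) \<in> k"
      using step gens by (intro br) auto
    then have "Poly_Mapping.single (Vd (j + 1)) (of_int (j - 1)) \<in> k"
      using step(1) by (simp add: vir_bracket_d)
    then have "pm_scale (1 / of_int (j - 1)) (Poly_Mapping.single (Vd (j + 1)) (of_int (j - 1))) \<in> k"
      by (rule PM.subspace_scale[OF sub])
    moreover have "pm_scale (1 / of_int (j - 1)) (Poly_Mapping.single (Vd (j + 1)) (of_int (j - 1)))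
        = Poly_Mapping.single (Vd (j + 1)) (1 :: complex)"
    proof -
      have "(of_int (j - 1) :: complex) \<noteq> 0"
        using step(1) unfolding of_int_eq_0_iff by linarith
      then show ?thesis
        by (intro poly_mapping_eqI) (simp add: lookup_single when_def)
    qed
    ultimately show ?case by simp
  qed
  have "Poly_Mapping.single (Vd j) 1 \<in> k" if "j > 0" for j
    using that ge2[of j] gens by (cases "j = 1") auto
  then show ?thesis
    unfolding vir_n_plus_def by (intro PM.span_minimal[OF _ sub]) blast
qed

theorem theorem3p1:
  fixes scX :: "complex \<Rightarrow> 'x::ab_group_add \<Rightarrow> 'x" and actX :: "vir \<Rightarrow> 'x \<Rightarrow> 'x"
    and scY :: "complex \<Rightarrow> 'y::ab_group_add \<Rightarrow> 'y" and actY :: "vir \<Rightarrow> 'y \<Rightarrow> 'y"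
    and scZ :: "complex \<Rightarrow> 'z::ab_group_add \<Rightarrow> 'z" and actZ :: "vir \<Rightarrow> 'z \<Rightarrow> 'z"
    and f :: "'x \<Rightarrow> 'y" and g :: "'y \<Rightarrow> 'z"
  assumes "vir_short_exact scX actX scY actY scZ actZ f g"
    and "in_cat_W scX actX"
    and "in_cat_W scZ actZ"
  shows "in_cat_W scY actY"
proof -
  let ?d = "\<lambda>k. Poly_Mapping.single (Vd k) (1 :: complex)"
  have "vir_module scY actY"
    using assms(1) by (simp add: lie_short_exact_def lie_module_hom_def)
  moreover have "acts_locally_finitely pm_scale vir_bracket vir_n_plus scY actY"
  proof (rule acts_locally_finitely_extension[OF assms(1) lie_subalgebra_vir_n_plus])
    show "finite {?d 1, ?d 2}" by simp
    show "{?d 1, ?d 2} \<subseteq> vir_n_plus"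
      unfolding vir_n_plus_def by (intro subset_trans[OF _ PM.span_superset]) auto
    show "vir_n_plus \<subseteq> k" if "Vir.lie_subalgebra k" "{?d 1, ?d 2} \<subseteq> k" for k
      using that by (rule vir_n_plus_generated)
  qed (use assms(2,3) in \<open>simp_all add: in_cat_W_def\<close>)
  ultimately show ?thesis by (simp add: in_cat_W_def)
qed

end
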